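(* Let $\mathbf{G}$ be the fully connected weighted graph on the vertices $v_1,\dots,v_n$, and suppose that $\mathbf{G}$ has no equivalent edges. For each pair of vertices $v_i,v_j$ let $\mathrm{OP}_{ij}$ be the optimal path between $v_i$ and $v_j$, and let $\mathrm{MST}(\mathbf{G})$ be the maximum spanning tree of $\mathbf{G}$. Then, as sets of edges, $$\bigcup_{i,j=1}^{n}\mathrm{OP}_{ij}=\mathrm{MST}(\mathbf{G}).$$
   Context: Given $n$ data points (vertices) $v_1,\dots,v_n$ in a Euclidean space, $\mathbf{G}$ is the complete undirected graph on them with edge weights $w_{ij}=\exp\left(-\frac{\|v_i-v_j\|^2}{2\sigma^2}\right)$, where $\sigma>0$ is fixed. Optimal path: for $i\neq j$ let $\mathbf{P}_{ij}$ be the set of all paths in $\mathbf{G}$ from $v_i$ to $v_j$. The path-based weight of a path is the minimum of the weights of its edges. The optimal path $\mathrm{OP}_{ij}$ is a path in $\mathbf{P}_{ij}$ having the maximum path-based weight among all paths in $\mathbf{P}_{ij}$; that maximum, $\widehat w_{ij}=\max_{p\in\mathbf{P}_{ij}}\min_{e\in p}w_e$, is the path-based similarity of $v_i$ and $v_j$. $\mathrm{OP}_{ij}$ is identified with its set of edges (for $i=j$ it is empty). Equivalent edges: distinct edges lying on a common loop (cycle) of $\mathbf{G}$ which both have the minimum weight among the edges of that loop (so that deleting any one of them does not affect the path-based similarity of any pair of vertices). Maximum spanning tree: a spanning tree of $\mathbf{G}$ whose sum of edge weights is maximum among all spanning trees of $\mathbf{G}$, identified with its set of edges.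
   Formalization: Optimal paths need not be unique and the equality fails for some choices (points 0,1,3,7 on a line), so what is proved is: the union contains MST(G) for every choice of optimal paths, and equals MST(G) for some choice. *)

theory Defs
  imports "HOL-Analysis.Analysis"
begin

text \<open>
  An undirected simple graph is given by a vertex set \<open>V\<close> and a set \<open>E\<close> of two-element subsets
  of \<open>V\<close>; paths and loops are given by their lists of vertices. (The trees of the AFP entry
  Graph-Theory are digraphs without \<^emph>\<open>directed\<close> cycles, hence not trees in the present sense.)
\<close>

definition complete_edges :: "'v set \<Rightarrow> 'v set set" where
  "complete_edges V = {{a, b} | a b. a \<in> V \<and> b \<in> V \<and> a \<noteq> b}"

definition path_edges :: "'v list \<Rightarrow> 'v set set" where
  "path_edges p = {{p ! k, p ! Suc k} | k. Suc k < length p}"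

text \<open>For \<open>i = j\<close> the only path is \<open>[i]\<close>, which has no edges.\<close>

definition paths :: "'v set \<Rightarrow> 'v set set \<Rightarrow> 'v \<Rightarrow> 'v \<Rightarrow> 'v list set" where
  "paths V E i j =
    {p. p \<noteq> [] \<and> hd p = i \<and> last p = j \<and> distinct p \<and> set p \<subseteq> V \<and> path_edges p \<subseteq> E}"

definition loop_edges :: "'v list \<Rightarrow> 'v set set" where
  "loop_edges c = insert {last c, hd c} (path_edges c)"

definition loops :: "'v set \<Rightarrow> 'v set set \<Rightarrow> 'v list set" where
  "loops V E = {c. 3 \<le> length c \<and> distinct c \<and> set c \<subseteq> V \<and> loop_edges c \<subseteq> E}"

text \<open>
  For \<open>i = j\<close> the value \<open>Min {}\<close> occurs, but harmlessly: there is only one path to compare, so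
  \<open>optimal_paths V E w i i = {[i]}\<close>.
\<close>

definition path_weight :: "('v set \<Rightarrow> real) \<Rightarrow> 'v list \<Rightarrow> real" where
  "path_weight w p = Min (w ` path_edges p)"

definition optimal_paths ::
  "'v set \<Rightarrow> 'v set set \<Rightarrow> ('v set \<Rightarrow> real) \<Rightarrow> 'v \<Rightarrow> 'v \<Rightarrow> 'v list set" where
  "optimal_paths V E w i j =
    {p \<in> paths V E i j. \<forall>q \<in> paths V E i j. path_weight w q \<le> path_weight w p}"

definition equivalent_edges ::
  "'v set \<Rightarrow> 'v set set \<Rightarrow> ('v set \<Rightarrow> real) \<Rightarrow> 'v set \<Rightarrow> 'v set \<Rightarrow> bool" where
  "equivalent_edges V E w e f \<longleftrightarrow> e \<noteq> f \<and>
    (\<exists>c \<in> loops V E. e \<in> loop_edges c \<and> f \<in> loop_edges c \<and>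
      w e = Min (w ` loop_edges c) \<and> w f = Min (w ` loop_edges c))"

definition spanning_tree :: "'v set \<Rightarrow> 'v set set \<Rightarrow> 'v set set \<Rightarrow> bool" where
  "spanning_tree V E T \<longleftrightarrow>
    T \<subseteq> E \<and> (\<forall>i \<in> V. \<forall>j \<in> V. paths V T i j \<noteq> {}) \<and> loops V T = {}"

definition maximum_spanning_tree ::
  "'v set \<Rightarrow> 'v set set \<Rightarrow> ('v set \<Rightarrow> real) \<Rightarrow> 'v set set \<Rightarrow> bool" where
  "maximum_spanning_tree V E w T \<longleftrightarrow>
    spanning_tree V E T \<and> (\<forall>T'. spanning_tree V E T' \<longrightarrow> sum w T' \<le> sum w T)"

text \<open>
  The weight of an edge \<open>{i, j}\<close>; \<open>Min\<close> and \<open>Max\<close> only serve to recover the two end points.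
\<close>

definition gauss_weight ::
  "real \<Rightarrow> (nat \<Rightarrow> 'a::euclidean_space) \<Rightarrow> nat set \<Rightarrow> real" where
  "gauss_weight \<sigma> v e = exp (- ((norm (v (Min e) - v (Max e)))\<^sup>2 / (2 * \<sigma>\<^sup>2)))"

lemma gauss_weight_edge:
  "gauss_weight \<sigma> v {i, j} = exp (- ((norm (v i - v j))\<^sup>2 / (2 * \<sigma>\<^sup>2)))"
  by (cases "i \<le> j") (simp_all add: gauss_weight_def min_def max_def norm_minus_commute)

text \<open>
  Optimal paths need not be unique, even if all edge weights are distinct: for the points
  \<open>0, 1, 3, 7\<close> of the real line, numbered 1 to 4, both \<open>[1, 2, 3, 4]\<close> and \<open>[1, 3, 4]\<close> are optimal
  paths from 1 to 4 (their lightest edge is \<open>{3, 4}\<close>), but \<open>{1, 3}\<close> is not an edge of the maximum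
  spanning tree. The family \<open>OP\<close> of optimal paths is therefore a choice.
\<close>

definition optimal_path_family ::
  "'v set \<Rightarrow> 'v set set \<Rightarrow> ('v set \<Rightarrow> real) \<Rightarrow> ('v \<Rightarrow> 'v \<Rightarrow> 'v list) \<Rightarrow> bool" where
  "optimal_path_family V E w OP \<longleftrightarrow> (\<forall>i \<in> V. \<forall>j \<in> V. OP i j \<in> optimal_paths V E w i j)"

end

theory Submission
  imports Defs
begin

text \<open>
  Exchange argument: deleting an edge \<open>e\<close> from a maximum spanning tree \<open>T\<close> splits it into two
  components, and any edge between them completes \<open>T - {e}\<close> to a spanning tree. Hence a path
  of the graph joining the two components contains an edge of weight at most \<open>w e\<close>. Taking for \<open>e\<close> the
  lightest edge of a tree path shows that tree paths are optimal. If an optimal path between the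
  end points of \<open>e \<in> T\<close> avoided \<open>e\<close>, it would form a loop with \<open>e\<close>, on which \<open>e\<close> is strictly
  lightest as there are no equivalent edges, a contradiction.
\<close>

section \<open>Edges of paths and loops\<close>

lemma path_edges_Nil [simp]: "path_edges [] = {}"
  and path_edges_single [simp]: "path_edges [x] = {}"
  by (simp_all add: path_edges_def)

lemma path_edges_eq_image: "path_edges p = (\<lambda>k. {p ! k, p ! Suc k}) ` {k. Suc k < length p}"
  by (auto simp: path_edges_def)

text \<open>Recursive form of the index-based definition, for inductions on lists.\<close>

lemma path_edges_Cons_Cons [simp]:
  "path_edges (x # y # zs) = insert {x, y} (path_edges (y # zs))"
proof -
  have "{k. Suc k < length (x # y # zs)} = insert 0 (Suc ` {k. Suc k < length (y # zs)})"
  proof (rule set_eqI)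
    fix k show "k \<in> {k. Suc k < length (x # y # zs)} \<longleftrightarrow>
        k \<in> insert 0 (Suc ` {k. Suc k < length (y # zs)})"
      by (cases k) auto
  qed
  then show ?thesis
    unfolding path_edges_eq_image by (simp only: image_insert image_image) simp
qed

lemma path_edges_append:
  assumes "xs \<noteq> []" "ys \<noteq> []"
  shows "path_edges (xs @ ys) = insert {last xs, hd ys} (path_edges xs \<union> path_edges ys)"
  using assms(1)
proof (induction xs rule: list_nonempty_induct)
  case (single x)
  then show ?case using assms(2) by (cases ys) auto
next
  case (cons x xs)
  then show ?case by (cases xs) auto
qed

lemma path_edges_split:
  assumes "e \<in> path_edges p"
  obtains xs x y ys where "p = xs @ x # y # ys" "e = {x, y}"
proof -
  obtain k where k: "Suc k < length p" "e = {p ! k, p ! Suc k}"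
    using assms by (auto simp: path_edges_def)
  then have "p = take k p @ p ! k # p ! Suc k # drop (Suc (Suc k)) p"
    by (metis Cons_nth_drop_Suc Suc_lessD append_take_drop_id)
  then show thesis using k(2) that by blast
qed

lemma path_edges_subset_set: "e \<in> path_edges p \<Longrightarrow> e \<subseteq> set p"
  by (auto elim!: path_edges_split)

text \<open>The first vertex lies on a single path edge, whose other end is the second vertex and
  hence not the last one. With only two vertices the closing edge would be the path edge
  itself.\<close>

lemma closing_edge_notin_path_edges:
  assumes "distinct p" "3 \<le> length p"
  shows "{last p, hd p} \<notin> path_edges p"
proof -
  obtain x y z r where p: "p = x # y # z # r"
    using assms(2) by (auto simp: numeral_3_eq_3 Suc_le_length_iff)
  have "last (z # r) \<in> set (z # r)"
    by (rule last_in_set) simp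
  then have "last p \<noteq> x" "last p \<noteq> y"
    using assms(1) p by auto
  moreover have "{last p, x} \<notin> path_edges (y # z # r)"
    using path_edges_subset_set [of "{last p, x}" "y # z # r"] assms(1) p by auto
  ultimately show ?thesis
    using p by (auto simp: doubleton_eq_iff simp del: last.simps)
qed

text \<open>Allows any edge of a loop to be made its closing edge.\<close>

lemma loop_edges_rotate:
  assumes "xs \<noteq> []" "ys \<noteq> []"
  shows "loop_edges (xs @ ys) = loop_edges (ys @ xs)"
  using assms by (auto simp: loop_edges_def path_edges_append)

section \<open>Connectivity by edges of a given set\<close>

definition joined :: "'v set set \<Rightarrow> ('v \<times> 'v) set" where
  "joined F = {(x, y). {x, y} \<in> F}\<^sup>*"

lemma joined_refl: "(x, x) \<in> joined F"
  by (simp add: joined_def)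

lemma joined_edge: "{x, y} \<in> F \<Longrightarrow> (x, y) \<in> joined F"
  by (auto simp: joined_def)

lemma joined_trans: "(x, y) \<in> joined F \<Longrightarrow> (y, z) \<in> joined F \<Longrightarrow> (x, z) \<in> joined F"
  by (auto simp: joined_def)

lemma joined_sym:
  assumes "(x, y) \<in> joined F" shows "(y, x) \<in> joined F"
proof -
  have "sym {(x, y). {x, y} \<in> F}" by (auto simp: sym_def insert_commute)
  then show ?thesis using assms unfolding joined_def by (meson sym_rtrancl symD)
qed

text \<open>Since \<open>joined F'\<close> is reflexive and transitive, testing single edges
  suffices.\<close>

lemma joined_least:
  assumes "\<And>x y. {x, y} \<in> F \<Longrightarrow> (x, y) \<in> joined F'"
  shows "joined F \<subseteq> joined F'"
proof -
  have "{(x, y). {x, y} \<in> F} \<subseteq> joined F'" using assms by auto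
  then show ?thesis unfolding joined_def by (metis rtrancl_idemp rtrancl_mono)
qed

lemma joined_mono: "F \<subseteq> F' \<Longrightarrow> joined F \<subseteq> joined F'"
  by (rule joined_least) (auto intro: joined_edge)

section \<open>Paths and loops versus connectivity\<close>

lemma joined_path:
  assumes "p \<noteq> []" "path_edges p \<subseteq> F"
  shows "(hd p, last p) \<in> joined F"
  using assms
proof (induction p rule: list_nonempty_induct)
  case (single x)
  then show ?case by (simp add: joined_refl)
next
  case (cons x xs)
  then show ?case
    by (cases xs) (auto intro: joined_edge joined_trans)
qed

lemma joined_paths: "p \<in> paths V F i j \<Longrightarrow> (i, j) \<in> joined F"
  using joined_path by (auto simp: paths_def)

text \<open>If \<open>z\<close> already lies on \<open>p\<close>, truncating \<open>p\<close> there
  keeps the vertices distinct; otherwise \<open>z\<close> is appended.\<close>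

lemma paths_append_vertex:
  assumes p: "p \<in> paths V F i y" and "{y, z} \<in> F" "z \<in> V"
  shows "paths V F i z \<noteq> {}"
proof (cases "z \<in> set p")
  case True
  then obtain xs ys where xs: "p = xs @ z # ys" by (meson split_list)
  then have "path_edges (xs @ [z]) \<subseteq> path_edges p"
    using path_edges_append [of "xs @ [z]" ys] by (cases "ys = []") auto
  then have "xs @ [z] \<in> paths V F i z"
    using p xs by (auto simp: paths_def hd_append split: if_splits)
  then show ?thesis by blast
next
  case False
  then have "p @ [z] \<in> paths V F i z"
    using assms by (auto simp: paths_def path_edges_append)
  then show ?thesis by blast
qed

text \<open>The walks behind \<open>joined\<close> may repeat vertices, members of
  \<open>paths\<close> may not; a path is therefore rebuilt at each edge of the walk.\<close>

lemma paths_nonempty_of_joined: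
  assumes "(i, j) \<in> joined F" "F \<subseteq> complete_edges V" "i \<in> V"
  shows "paths V F i j \<noteq> {}"
  using assms(1) unfolding joined_def
proof (induction rule: rtrancl_induct)
  case base
  have "[i] \<in> paths V F i i" using assms(3) by (simp add: paths_def)
  then show ?case by blast
next
  case (step y z)
  then have "{y, z} \<in> F" by simp
  moreover have "z \<in> V" using calculation assms(2)
    by (auto simp: complete_edges_def doubleton_eq_iff)
  ultimately show ?case using step.IH paths_append_vertex by fast
qed

text \<open>Avoiding \<open>{a, b}\<close> rules out the path \<open>[a, b]\<close>, so
  \<open>p\<close> has the three vertices that a loop requires, and \<open>{a, b}\<close> becomes
  its closing edge.\<close>

lemma path_closes_to_loop:
  assumes p: "p \<in> paths V F a b" and ab: "a \<noteq> b" "{a, b} \<notin> path_edges p"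
    and "{a, b} \<in> F'" "F \<subseteq> F'"
  shows "p \<in> loops V F'" and "loop_edges p = insert {a, b} (path_edges p)"
proof -
  have p': "p \<noteq> []" "hd p = a" "last p = b" "distinct p" "set p \<subseteq> V" "path_edges p \<subseteq> F"
    using p by (auto simp: paths_def)
  obtain r where r: "p = a # r" using p' by (cases p) auto
  obtain y s where s: "r = y # s" using p' r ab by (cases r) auto
  have "s \<noteq> []" using p' r s ab by auto
  then have "3 \<le> length p" using r s by (cases s) auto
  moreover show le: "loop_edges p = insert {a, b} (path_edges p)"
    using p' by (simp add: loop_edges_def insert_commute)
  ultimately show "p \<in> loops V F'"
    using p' assms(4,5) by (auto simp: loops_def)
qed

text \<open>Every edge of a forest is a bridge: a path between its ends that avoids it would close
  to a loop.\<close>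

lemma not_joined_of_no_loop:
  assumes "loops V T = {}" "T \<subseteq> complete_edges V" "{a, b} \<in> T"
  shows "(a, b) \<notin> joined (T - {{a, b}})"
proof
  assume j: "(a, b) \<in> joined (T - {{a, b}})"
  have ab: "a \<in> V" "a \<noteq> b"
    using assms(2,3) by (auto simp: complete_edges_def doubleton_eq_iff)
  then obtain p where p: "p \<in> paths V (T - {{a, b}}) a b"
    using paths_nonempty_of_joined [OF j] assms(2) by blast
  then have "{a, b} \<notin> path_edges p" by (auto simp: paths_def)
  then show False
    using path_closes_to_loop(1) [OF p ab(2), of T] assms by blast
qed

text \<open>The loop must use \<open>f\<close>, and the rest of it connects the ends of
  \<open>f\<close> within \<open>F\<close>.\<close>

lemma joined_of_new_loop:
  assumes c: "c \<in> loops V (insert f F)" and F: "loops V F = {}" and f: "f = {x, y}"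
  shows "(x, y) \<in> joined F"
proof -
  obtain r where r: "r \<in> loops V (insert f F)" "f = {last r, hd r}"
  proof -
    have "f \<in> loop_edges c" using c F by (auto simp: loops_def)
    then consider "f = {last c, hd c}" | "f \<in> path_edges c"
      by (auto simp: loop_edges_def)
    then show thesis
    proof cases
      case 1
      then show thesis using c that by blast
    next
      case 2
      then obtain xs u v ys where s: "c = xs @ u # v # ys" "f = {u, v}"
        by (rule path_edges_split)
      \<comment> \<open>Rotation turns the inner edge \<open>f\<close> of \<open>c\<close> into the
        closing edge.\<close>
      let ?r = "(v # ys) @ (xs @ [u])"
      have "loop_edges ?r = loop_edges c"
        using loop_edges_rotate [of "v # ys" "xs @ [u]"] s by simp
      then have "?r \<in> loops V (insert f F)"
        using c s by (auto simp: loops_def)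
      moreover have "f = {last ?r, hd ?r}" using s by simp
      ultimately show thesis using that by blast
    qed
  qed
  \<comment> \<open>As the closing edge, \<open>f\<close> does not recur on \<open>r\<close>, so all
    other edges lie in \<open>F\<close>.\<close>
  then have "f \<notin> path_edges r"
    using closing_edge_notin_path_edges by (auto simp: loops_def)
  then have "path_edges r \<subseteq> F" "r \<noteq> []"
    using r(1) by (auto simp: loops_def loop_edges_def)
  then have "(hd r, last r) \<in> joined F" by (simp add: joined_path)
  moreover have "(x = last r \<and> y = hd r) \<or> (x = hd r \<and> y = last r)"
    using f r(2) by (auto simp: doubleton_eq_iff)
  ultimately show ?thesis using joined_sym by fast
qed

section \<open>Edge exchange and the cut property\<close>

lemma path_crosses:
  assumes "p \<noteq> []" "(hd p, last p) \<notin> joined F"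
  obtains x y where "{x, y} \<in> path_edges p" "(x, y) \<notin> joined F"
proof -
  have "(hd p, last p) \<in> joined (path_edges p)"
    by (rule joined_path [OF assms(1) subset_refl])
  \<comment> \<open>Otherwise \<open>F\<close> would join the ends of every edge of
    \<open>p\<close>, hence those of \<open>p\<close>.\<close>
  then show thesis
    using that joined_least [of "path_edges p" F] assms(2) by blast
qed

text \<open>A walk need cross the new edge at most once, as the part between two visits to the same
  end can be cut out. The last two alternatives are the two directions of crossing.\<close>

lemma joined_insert_edge:
  assumes "(x, y) \<in> joined (insert {a, b} F)"
  shows "(x, y) \<in> joined F \<or> (x, a) \<in> joined F \<and> (b, y) \<in> joined F
    \<or> (x, b) \<in> joined F \<and> (a, y) \<in> joined F"
  using assms unfolding joined_def [of "insert {a, b} F"]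
proof (induction rule: rtrancl_induct)
  case base
  then show ?case by (simp add: joined_refl)
next
  case (step y z)
  then consider "{y, z} \<in> F" | "y = a" "z = b" | "y = b" "z = a"
    by (auto simp: doubleton_eq_iff)
  then show ?case
  proof cases
    case 1
    then show ?thesis using step.IH joined_edge joined_trans by metis
  next
    case 2
    then show ?thesis using step.IH joined_refl joined_trans by metis
  next
    case 3
    then show ?thesis using step.IH joined_refl joined_trans by metis
  qed
qed

text \<open>The tree connects \<open>x\<close> and \<open>y\<close> only through \<open>e\<close>,
  so \<open>{x, y}\<close> can stand in for \<open>e\<close>. A loop through \<open>{x, y}\<close>
  would connect \<open>x\<close> and \<open>y\<close> without \<open>e\<close>.\<close>

lemma spanning_tree_exchange:
  assumes T: "spanning_tree V E T" and E: "E \<subseteq> complete_edges V" and e: "e \<in> T"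
    and xy: "{x, y} \<in> E" "(x, y) \<notin> joined (T - {e})"
  shows "spanning_tree V E (insert {x, y} (T - {e}))"
proof -
  have T': "T \<subseteq> E" "loops V T = {}" "\<And>i j. i \<in> V \<Longrightarrow> j \<in> V \<Longrightarrow> (i, j) \<in> joined T"
    using T joined_paths by (fastforce simp: spanning_tree_def)+
  obtain a b where ab: "e = {a, b}"
    using e T'(1) E by (auto simp: complete_edges_def)
  define F where "F = T - {e}"
  have T_eq: "T = insert {a, b} F" using e ab F_def by auto
  define T2 where "T2 = insert {x, y} F"
  have F_T2: "(u, z) \<in> joined T2" if "(u, z) \<in> joined F" for u z
    using that joined_mono [of F T2] T2_def by blast
  have xyV: "x \<in> V" "y \<in> V"
    using xy(1) E by (auto simp: complete_edges_def doubleton_eq_iff)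
  have xy2: "(x, y) \<in> joined T2" by (rule joined_edge) (simp add: T2_def)
  have "(x, y) \<in> joined (insert {a, b} F)"
    using T'(3) [OF xyV] unfolding T_eq .
  then have "(x, a) \<in> joined F \<and> (b, y) \<in> joined F \<or> (x, b) \<in> joined F \<and> (a, y) \<in> joined F"
    using joined_insert_edge [of x y a b F] xy(2) [folded F_def] by blast
  \<comment> \<open>The ends of \<open>e\<close> are connected by the detour across
    \<open>{x, y}\<close>.\<close>
  then have ab2: "(a, b) \<in> joined T2"
    using xy2 F_T2 joined_sym joined_trans by metis
  have "joined T \<subseteq> joined T2"
  proof (rule joined_least)
    fix u z assume "{u, z} \<in> T"
    then consider "{u, z} \<in> F" | "u = a" "z = b" | "u = b" "z = a"
      using T_eq by (auto simp: doubleton_eq_iff)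
    then show "(u, z) \<in> joined T2"
    proof cases
      case 1
      then show ?thesis by (intro F_T2 joined_edge)
    next
      case 2
      then show ?thesis using ab2 by simp
    next
      case 3
      then show ?thesis using joined_sym [OF ab2] by simp
    qed
  qed
  moreover have T2E: "T2 \<subseteq> E" using T'(1) xy(1) by (auto simp: T2_def F_def)
  ultimately have "\<forall>i\<in>V. \<forall>j\<in>V. paths V T2 i j \<noteq> {}"
    using T'(3) paths_nonempty_of_joined [of _ _ T2 V] E by blast
  moreover have "loops V F = {}" using T'(2) by (auto simp: loops_def F_def)
  then have "loops V T2 = {}"
    using joined_of_new_loop xy(2) unfolding T2_def F_def by fast
  ultimately show ?thesis
    using T2E by (simp add: spanning_tree_def T2_def F_def)
qed

lemma finite_complete_edges: "finite V \<Longrightarrow> finite (complete_edges V)"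
  by (rule finite_subset [of _ "Pow V"]) (auto simp: complete_edges_def)

text \<open>Some edge of \<open>q\<close> crosses the cut left by \<open>e\<close>; exchanging
  \<open>e\<close> for it cannot increase the total weight.\<close>

lemma maximum_spanning_tree_cut:
  assumes T: "maximum_spanning_tree V E w T" and E: "E \<subseteq> complete_edges V" and V: "finite V"
    and e: "e \<in> T" and q: "q \<in> paths V E i j" and cut: "(i, j) \<notin> joined (T - {e})"
  shows "\<exists>f \<in> path_edges q. w f \<le> w e"
proof -
  have q': "q \<noteq> []" "hd q = i" "last q = j" "path_edges q \<subseteq> E"
    using q by (auto simp: paths_def)
  then obtain x y where xy: "{x, y} \<in> path_edges q" "(x, y) \<notin> joined (T - {e})"
    using path_crosses [of q] cut by metis
  have "spanning_tree V E T"
    using T by (simp add: maximum_spanning_tree_def)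
  then have "spanning_tree V E (insert {x, y} (T - {e}))" and "T \<subseteq> E"
    using spanning_tree_exchange [OF _ E e _ xy(2)] q' xy(1) by (auto simp: spanning_tree_def)
  then have "sum w (insert {x, y} (T - {e})) \<le> sum w T" and "finite T"
    using T finite_subset [OF _ finite_complete_edges [OF V]] E
    by (simp_all add: maximum_spanning_tree_def subset_trans)
  \<comment> \<open>The crossing edge may be \<open>e\<close> itself but no other tree edge, so the
    two sums differ by exactly \<open>w {x, y} - w e\<close>.\<close>
  moreover have "{x, y} \<notin> T - {e}"
    using xy(2) by (rule contrapos_nn) (rule joined_edge)
  moreover have "sum w T = w e + sum w (T - {e})"
    using \<open>finite T\<close> e by (rule sum.remove)
  ultimately have "w {x, y} \<le> w e"
    by (simp only: sum.insert finite_Diff) simp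
  then show ?thesis using xy(1) by blast
qed

text \<open>The pieces of \<open>p\<close> before and after \<open>e\<close> avoid \<open>e\<close>;
  another connection of \<open>i\<close> and \<open>j\<close> without \<open>e\<close> would join
  the ends of \<open>e\<close>, which is a bridge.\<close>

lemma path_edge_cuts_tree:
  assumes T: "loops V T = {}" "T \<subseteq> complete_edges V"
    and p: "p \<in> paths V T i j" and e: "e \<in> path_edges p"
  shows "(i, j) \<notin> joined (T - {e})"
proof
  assume ij: "(i, j) \<in> joined (T - {e})"
  obtain xs x y ys where s: "p = xs @ x # y # ys" "e = {x, y}"
    using e by (rule path_edges_split)
  have p': "hd p = i" "last p = j" "distinct p" "path_edges p \<subseteq> T"
    using p by (auto simp: paths_def)
  have pe: "path_edges p = insert {x, y} (path_edges (xs @ [x]) \<union> path_edges (y # ys))"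
    using path_edges_append [of "xs @ [x]" "y # ys"] s by simp
  \<comment> \<open>By distinctness neither piece contains both ends of \<open>e\<close>.\<close>
  have "e \<notin> path_edges (xs @ [x])" "e \<notin> path_edges (y # ys)"
    using path_edges_subset_set [of e] s p'(3) by fastforce+
  then have "path_edges (xs @ [x]) \<subseteq> T - {e}" "path_edges (y # ys) \<subseteq> T - {e}"
    using pe p'(4) by auto
  then have "(hd (xs @ [x]), x) \<in> joined (T - {e})" "(y, last (y # ys)) \<in> joined (T - {e})"
    using joined_path [of "xs @ [x]"] joined_path [of "y # ys"] by auto
  moreover have "hd (xs @ [x]) = i" "last (y # ys) = j"
    using p' s by (cases xs; auto)+
  ultimately have "(x, y) \<in> joined (T - {e})"
    using ij joined_sym joined_trans by metis
  then show False
    using not_joined_of_no_loop [OF T, of x y] e p'(4) s by blast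
qed

section \<open>Tree paths and optimal paths\<close>

lemma paths_same: "p \<in> paths V E i i \<Longrightarrow> p = [i]"
  by (cases p) (auto simp: paths_def split: if_splits)

lemma finite_path_edges [simp]: "finite (path_edges p)"
proof -
  have "finite {k. Suc k < length p}"
    by (rule finite_subset [of _ "{..<length p}"]) auto
  then show ?thesis by (simp add: path_edges_eq_image)
qed

lemma path_edges_nonempty: "p \<in> paths V E i j \<Longrightarrow> i \<noteq> j \<Longrightarrow> path_edges p \<noteq> {}"
  by (cases p rule: remdups_adj.cases) (auto simp: paths_def)

lemma tree_path_optimal:
  assumes T: "maximum_spanning_tree V E w T" and E: "E \<subseteq> complete_edges V" and V: "finite V"
    and p: "p \<in> paths V T i j"
  shows "p \<in> optimal_paths V E w i j"
proof -
  have T': "T \<subseteq> E" "loops V T = {}"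
    using T by (auto simp: maximum_spanning_tree_def spanning_tree_def)
  have "path_weight w q \<le> path_weight w p" if q: "q \<in> paths V E i j" for q
  proof (cases "i = j")
    case True
    \<comment> \<open>Both weights are the unspecified \<open>Min {}\<close>, but the paths
      coincide.\<close>
    then have "p = [i]" "q = [i]" using p q paths_same by metis+
    then show ?thesis by simp
  next
    case False
    then have "Min (w ` path_edges p) \<in> w ` path_edges p"
      using path_edges_nonempty [OF p] by (intro Min_in) auto
    then obtain e where e: "e \<in> path_edges p" "path_weight w p = w e"
      by (auto simp: path_weight_def)
    then have "(i, j) \<notin> joined (T - {e})"
      using path_edge_cuts_tree [OF T'(2) _ p] T'(1) E by blast
    moreover have "e \<in> T" using e p by (auto simp: paths_def)
    ultimately obtain f where f: "f \<in> path_edges q" "w f \<le> w e"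
      using maximum_spanning_tree_cut [OF T E V _ q] by blast
    then have "path_weight w q \<le> w f" by (simp add: path_weight_def)
    then show ?thesis using f e by simp
  qed
  moreover have "p \<in> paths V E i j" using p T' by (auto simp: paths_def)
  ultimately show ?thesis by (simp add: optimal_paths_def)
qed

text \<open>Speaks of every optimal path between the ends, so that the inclusion of the tree holds
  for any choice of optimal paths.\<close>

lemma tree_edge_in_optimal_path:
  assumes T: "maximum_spanning_tree V E w T" and E: "E \<subseteq> complete_edges V" and V: "finite V"
    and no_eq: "\<nexists>e f. equivalent_edges V E w e f"
    and e: "{a, b} \<in> T" and p: "p \<in> optimal_paths V E w a b"
  shows "{a, b} \<in> path_edges p"
proof (rule ccontr)
  assume notin: "{a, b} \<notin> path_edges p"
  have T': "T \<subseteq> E" "loops V T = {}"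
    using T by (auto simp: maximum_spanning_tree_def spanning_tree_def)
  have ab: "a \<in> V" "b \<in> V" "a \<noteq> b"
    using e T' E by (auto simp: complete_edges_def doubleton_eq_iff)
  have p': "p \<in> paths V E a b" using p by (simp add: optimal_paths_def)
  have eE: "{a, b} \<in> E" using e T' by blast
  note loop = path_closes_to_loop [OF p' ab(3) notin eE subset_refl]
  \<comment> \<open>The single edge competes with \<open>p\<close>, so by optimality no edge of
    \<open>p\<close> is lighter than \<open>{a, b}\<close>.\<close>
  have "[a, b] \<in> paths V E a b" using ab eE by (auto simp: paths_def)
  then have "w {a, b} \<le> path_weight w p"
    using p by (force simp: optimal_paths_def path_weight_def)
  then have le: "w {a, b} \<le> w f" if "f \<in> path_edges p" for f
    using that by (auto simp: path_weight_def intro: order_trans)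
  then have min: "Min (w ` loop_edges p) = w {a, b}"
    unfolding loop(2) by (intro Min_eqI) auto
  \<comment> \<open>Equality would give two distinct lightest edges on the loop closed by
    \<open>{a, b}\<close>.\<close>
  have "w {a, b} < w f" if f: "f \<in> path_edges p" for f
  proof (rule ccontr)
    assume "\<not> ?thesis"
    then have "w f = w {a, b}" using le [OF f] by simp
    then have "equivalent_edges V E w {a, b} f"
      using f notin min loop unfolding equivalent_edges_def by (metis insertCI)
    then show False using no_eq by blast
  qed
  moreover have "(a, b) \<notin> joined (T - {{a, b}})"
    using not_joined_of_no_loop [OF T'(2) _ e] T'(1) E by blast
  ultimately show False
    using maximum_spanning_tree_cut [OF T E V e p'] by fastforce
qed

theorem theorem2:
  fixes v :: "nat \<Rightarrow> 'a::euclidean_space" and \<sigma> :: real and n :: nat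
    and V :: "nat set" and E MST :: "nat set set" and w :: "nat set \<Rightarrow> real"
  assumes "\<sigma> > 0"
    and "V = {1..n}" and "E = complete_edges V" and "w = gauss_weight \<sigma> v"
    and "\<not> (\<exists>e f. equivalent_edges V E w e f)"
    and "maximum_spanning_tree V E w MST"
  shows "(\<forall>OP. optimal_path_family V E w OP \<longrightarrow>
            MST \<subseteq> (\<Union>i\<in>{1..n}. \<Union>j\<in>{1..n}. path_edges (OP i j))) \<and>
         (\<exists>OP. optimal_path_family V E w OP \<and>
            (\<Union>i\<in>{1..n}. \<Union>j\<in>{1..n}. path_edges (OP i j)) = MST)"
proof -
  have E: "E \<subseteq> complete_edges V" and V: "finite V" using assms by auto
  note mst = \<open>maximum_spanning_tree V E w MST\<close>
  have T: "MST \<subseteq> E" "\<And>i j. i \<in> V \<Longrightarrow> j \<in> V \<Longrightarrow> paths V MST i j \<noteq> {}"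
    using mst by (auto simp: maximum_spanning_tree_def spanning_tree_def)
  \<comment> \<open>Each tree edge lies on the path chosen for its own end points.\<close>
  have sub: "MST \<subseteq> (\<Union>i\<in>V. \<Union>j\<in>V. path_edges (OP i j))"
    if "optimal_path_family V E w OP" for OP
  proof
    fix e assume e: "e \<in> MST"
    then obtain a b where ab: "e = {a, b}" "a \<in> V" "b \<in> V"
      using T(1) E by (force simp: complete_edges_def)
    then have "OP a b \<in> optimal_paths V E w a b"
      using that by (simp add: optimal_path_family_def)
    then have "e \<in> path_edges (OP a b)"
      using tree_edge_in_optimal_path [OF mst E V assms(5)] e ab(1) by blast
    then show "e \<in> (\<Union>i\<in>V. \<Union>j\<in>V. path_edges (OP i j))" using ab by blast
  qed
  \<comment> \<open>The witness chooses paths inside the tree: these are optimal and contribute only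
    tree edges.\<close>
  define OP where "OP i j = (SOME p. p \<in> paths V MST i j)" for i j
  have OP: "OP i j \<in> paths V MST i j" if "i \<in> V" "j \<in> V" for i j
    using T(2) [OF that] unfolding OP_def by (simp add: some_in_eq)
  then have fam: "optimal_path_family V E w OP"
    using tree_path_optimal [OF mst E V] by (simp add: optimal_path_family_def)
  have "(\<Union>i\<in>V. \<Union>j\<in>V. path_edges (OP i j)) \<subseteq> MST"
    using OP by (fastforce simp: paths_def)
  then show ?thesis
    using sub fam unfolding \<open>V = {1..n}\<close> by blast
qed

end
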